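(* Let $k\in[0,1)$ and let $S$ be a weakly regular AG-groupoid with left identity $e$. Then the following conditions are equivalent: (i) $S$ is regular and intra-regular. (ii) $f\circ_k f=f_k$ for every $(\in,\in\vee q_k)$-fuzzy quasi-ideal $f$ of $S$. (iii) $f\circ_k f=f_k$ for every $(\in,\in\vee q_k)$-fuzzy bi-ideal $f$ of $S$. (iv) $f\circ_k g\ge f\wedge_k g$ for all $(\in,\in\vee q_k)$-fuzzy quasi-ideals $f$ and $g$ of $S$. (v) $f\circ_k g\ge f\wedge_k g$ for every $(\in,\in\vee q_k)$-fuzzy quasi-ideal $f$ and every $(\in,\in\vee q_k)$-fuzzy bi-ideal $g$ of $S$. (vi) $f\circ_k g\ge f\wedge_k g$ for all $(\in,\in\vee q_k)$-fuzzy bi-ideals $f$ and $g$ of $S$.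
   Context: An AG-groupoid is a (non-empty) set $S$ with a binary operation satisfying $(ab)c=(cb)a$ for all $a,b,c\in S$. A left identity is an element $e$ with $ea=a$ for all $a$. $S$ is weakly regular if for each $a\in S$ there are $x,y\in S$ with $a=(ax)(ay)$; $S$ is regular if for each $a\in S$ there is $x\in S$ with $a=(ax)a$; $S$ is intra-regular if for each $a\in S$ there are $x,y\in S$ with $a=(xa^2)y$, where $a^2=aa$. A fuzzy subset of $S$ is a map $f:S\to[0,1]$; $\wedge$ denotes minimum, and inequalities between fuzzy subsets are pointwise. $1$ denotes the constant fuzzy subset with value $1$. The product is $(f\circ g)(a)=\sup_{a=bc}\, (f(b)\wedge g(c))$ (supremum over all $b,c\in S$ with $a=bc$), and $(f\circ g)(a)=0$ if $a$ is not a product of two elements. Further, $f_k(a)=f(a)\wedge\frac{1-k}{2}$, $(f\wedge_k g)(a)=f(a)\wedge g(a)\wedge\frac{1-k}{2}$ and $(f\circ_k g)(a)=(f\circ g)(a)\wedge\frac{1-k}{2}$. For $x\in S$, $t\in(0,1]$: $x_t\in f$ means $f(x)\ge t$; $x_t q_k f$ means $f(x)+t+k>1$; $x_t\in\vee q_k f$ means $x_t\in f$ or $x_tq_kf$. A fuzzy subset $f$ is an $(\in,\in\vee q_k)$-fuzzy: - subgroupoid if $x_t\in f$ and $y_r\in f$ imply $(xy)_{t\wedge r}\in\vee q_kf$; equivalently $f(xy)\ge f(x)\wedge f(y)\wedge\frac{1-k}{2}$ for all $x,y$; - bi-ideal if it is an $(\in,\in\vee q_k)$-fuzzy subgroupoid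 and $x_t\in f$, $z_r\in f$ imply $((xy)z)_{t\wedge r}\in\vee q_kf$ for all $y$; equivalently, a subgroupoid with $f((xy)z)\ge f(x)\wedge f(z)\wedge\frac{1-k}{2}$ for all $x,y,z$; - quasi-ideal if $f(x)\ge (f\circ 1)(x)\wedge(1\circ f)(x)\wedge\frac{1-k}{2}$ for all $x$. *)

theory Defs
  imports Complex_Main
begin

text \<open>The underlying set of the groupoid is the (non-empty) type \<open>'a\<close>, with an explicit binary operation.\<close>

context
  fixes mult :: "'a \<Rightarrow> 'a \<Rightarrow> 'a"  (infixl \<open>\<cdot>\<close> 70)
begin

definition ag_groupoid :: bool where
  "ag_groupoid \<longleftrightarrow> (\<forall>a b c. (a \<cdot> b) \<cdot> c = (c \<cdot> b) \<cdot> a)"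

definition left_identity :: "'a \<Rightarrow> bool" where
  "left_identity e \<longleftrightarrow> (\<forall>a. e \<cdot> a = a)"

definition weakly_regular :: bool where
  "weakly_regular \<longleftrightarrow> (\<forall>a. \<exists>x y. a = (a \<cdot> x) \<cdot> (a \<cdot> y))"

definition regular :: bool where
  "regular \<longleftrightarrow> (\<forall>a. \<exists>x. a = (a \<cdot> x) \<cdot> a)"

definition intra_regular :: bool where
  "intra_regular \<longleftrightarrow> (\<forall>a. \<exists>x y. a = (x \<cdot> (a \<cdot> a)) \<cdot> y)"

definition fuzzy_prod :: "('a \<Rightarrow> real) \<Rightarrow> ('a \<Rightarrow> real) \<Rightarrow> 'a \<Rightarrow> real" where
  "fuzzy_prod f g a =
     (if \<exists>b c. a = b \<cdot> c then Sup {min (f b) (g c) | b c. a = b \<cdot> c} else 0)"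

end

definition fuzzy_subset :: "('a \<Rightarrow> real) \<Rightarrow> bool" where
  "fuzzy_subset f \<longleftrightarrow> (\<forall>x. 0 \<le> f x \<and> f x \<le> 1)"

definition cut_k :: "real \<Rightarrow> ('a \<Rightarrow> real) \<Rightarrow> 'a \<Rightarrow> real" where
  "cut_k k f a = min (f a) ((1 - k) / 2)"

definition meet_k :: "real \<Rightarrow> ('a \<Rightarrow> real) \<Rightarrow> ('a \<Rightarrow> real) \<Rightarrow> 'a \<Rightarrow> real" where
  "meet_k k f g a = min (min (f a) (g a)) ((1 - k) / 2)"

definition prod_k ::
    "('a \<Rightarrow> 'a \<Rightarrow> 'a) \<Rightarrow> real \<Rightarrow> ('a \<Rightarrow> real) \<Rightarrow> ('a \<Rightarrow> real) \<Rightarrow> 'a \<Rightarrow> real" where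
  "prod_k mult k f g a = min (fuzzy_prod mult f g a) ((1 - k) / 2)"

text \<open>\<open>point_in x t f\<close>, \<open>point_q k x t f\<close> and \<open>point_in_or_q k x t f\<close> are the relations
  \<open>x\<^sub>t \<in> f\<close>, \<open>x\<^sub>t q\<^sub>k f\<close> and \<open>x\<^sub>t \<in>\<or>q\<^sub>k f\<close> for a fuzzy point \<open>x\<^sub>t\<close>; they are only used for \<open>t \<in> (0,1]\<close>.\<close>

definition point_in :: "'a \<Rightarrow> real \<Rightarrow> ('a \<Rightarrow> real) \<Rightarrow> bool" where
  "point_in x t f \<longleftrightarrow> f x \<ge> t"

definition point_q :: "real \<Rightarrow> 'a \<Rightarrow> real \<Rightarrow> ('a \<Rightarrow> real) \<Rightarrow> bool" where
  "point_q k x t f \<longleftrightarrow> f x + t + k > 1"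

definition point_in_or_q :: "real \<Rightarrow> 'a \<Rightarrow> real \<Rightarrow> ('a \<Rightarrow> real) \<Rightarrow> bool" where
  "point_in_or_q k x t f \<longleftrightarrow> point_in x t f \<or> point_q k x t f"

context
  fixes mult :: "'a \<Rightarrow> 'a \<Rightarrow> 'a"  (infixl \<open>\<cdot>\<close> 70)
    and k :: real
begin

definition fuzzy_subgroupoid :: "('a \<Rightarrow> real) \<Rightarrow> bool" where
  "fuzzy_subgroupoid f \<longleftrightarrow> fuzzy_subset f \<and>
     (\<forall>x y. \<forall>t\<in>{0<..1}. \<forall>r\<in>{0<..1}.
        point_in x t f \<longrightarrow> point_in y r f \<longrightarrow> point_in_or_q k (x \<cdot> y) (min t r) f)"

definition fuzzy_bi_ideal :: "('a \<Rightarrow> real) \<Rightarrow> bool" where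
  "fuzzy_bi_ideal f \<longleftrightarrow> fuzzy_subgroupoid f \<and>
     (\<forall>x y z. \<forall>t\<in>{0<..1}. \<forall>r\<in>{0<..1}.
        point_in x t f \<longrightarrow> point_in z r f \<longrightarrow> point_in_or_q k ((x \<cdot> y) \<cdot> z) (min t r) f)"

definition fuzzy_quasi_ideal :: "('a \<Rightarrow> real) \<Rightarrow> bool" where
  "fuzzy_quasi_ideal f \<longleftrightarrow> fuzzy_subset f \<and>
     (\<forall>x. f x \<ge> min (min (fuzzy_prod mult f (\<lambda>_. 1) x) (fuzzy_prod mult (\<lambda>_. 1) f x)) ((1 - k) / 2))"

end

end

theory Submission
  imports Defs
begin

text \<open>
  A weakly regular AG-groupoid with left identity is automatically regular and intra-regular,
  because every \<open>a = (ax)(ay) = (aa)(xy) = (yx)(aa)\<close>. So condition (i) always holds and it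
  remains to prove (ii)--(vi). From the same representation every \<open>a\<close> factors as
  \<open>a = a((aq)a)\<close>, which gives \<open>f \<circ>\<^sub>k g \<ge> f \<and>\<^sub>k g\<close> for all \<open>f\<close> and every bi-ideal \<open>g\<close>; and
  \<open>(xy)z \<in> xS\<close>, which makes every quasi-ideal a bi-ideal.
\<close>

section \<open>Fuzzy points versus pointwise inequalities\<close>

lemma point_in_or_q_iff:
  fixes f :: "'a \<Rightarrow> real" and k :: real
  assumes "0 \<le> k" and "k < 1" and "0 \<le> f w"
  shows "(\<forall>t\<in>{0<..1}. \<forall>r\<in>{0<..1}.
            point_in x t f \<longrightarrow> point_in y r f \<longrightarrow> point_in_or_q k w (min t r) f)
         \<longleftrightarrow> min (min (f x) (f y)) ((1 - k) / 2) \<le> f w" (is "?P \<longleftrightarrow> ?Q")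
proof
  assume P: ?P
  \<comment> \<open>Both points are tested at the common height \<open>m\<close>. Since
    \<open>2 * m \<le> 1 - k\<close>, the alternative \<open>f w + m + k > 1\<close> also forces
    \<open>m < f w\<close>. A nonpositive \<open>m\<close> is no admissible height, but then
    \<open>0 \<le> f w\<close> suffices.\<close>
  define m where "m = min (min (f x) (f y)) ((1 - k) / 2)"
  have "m \<le> f w"
  proof (cases "0 < m")
    case True
    have m: "m \<le> f x" "m \<le> f y" "m \<le> (1 - k) / 2"
      unfolding m_def by linarith+
    moreover have "m \<in> {0<..1}" using True m(3) assms(1) by simp
    ultimately have "m \<le> f w \<or> f w + m + k > 1"
      using P[rule_format, of m m] unfolding point_in_or_q_def point_in_def point_q_def by simp
    then show ?thesis
      using m(3) by (auto simp: field_simps)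
  qed (use assms in linarith)
  then show ?Q unfolding m_def .
next
  assume Q: ?Q
  have "min t r \<le> f w \<or> f w + min t r + k > 1" if "t \<le> f x" "r \<le> f y" for t r
  proof -
    \<comment> \<open>If \<open>min t r\<close> exceeds \<open>(1 - k) / 2\<close>, then
      \<open>f w\<close> is at least this threshold and the two sum to more than
      \<open>1 - k\<close>: the q-alternative. Otherwise membership holds.\<close>
    have "min t r \<le> f w \<or> (1 - k) / 2 \<le> f w" and "min t r \<le> (1 - k) / 2 \<longrightarrow> min t r \<le> f w"
      using that Q by (auto simp only: min_le_iff_disj intro: order_trans)
    then show ?thesis by (auto simp: field_simps)
  qed
  then show ?P
    unfolding point_in_or_q_def point_in_def point_q_def by blast
qed

lemma fuzzy_subgroupoid_iff:
  assumes "0 \<le> k" and "k < 1"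
  shows "fuzzy_subgroupoid mult k f \<longleftrightarrow>
    fuzzy_subset f \<and> (\<forall>x y. min (min (f x) (f y)) ((1 - k) / 2) \<le> f (mult x y))"
  unfolding fuzzy_subgroupoid_def
  by (rule conj_cong) (simp_all only: fuzzy_subset_def point_in_or_q_iff[OF assms])

lemma fuzzy_bi_ideal_iff:
  assumes "0 \<le> k" and "k < 1"
  shows "fuzzy_bi_ideal mult k f \<longleftrightarrow> fuzzy_subgroupoid mult k f \<and>
    (\<forall>x y z. min (min (f x) (f z)) ((1 - k) / 2) \<le> f (mult (mult x y) z))"
  unfolding fuzzy_bi_ideal_def
  by (rule conj_cong)
    (simp_all only: fuzzy_subgroupoid_iff[OF assms] fuzzy_subset_def point_in_or_q_iff[OF assms])

section \<open>Bounds on fuzzy products\<close>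

lemma fuzzy_prod_ge:
  assumes "fuzzy_subset f"
  shows "min (f b) (g c) \<le> fuzzy_prod mult f g (mult b c)"
proof -
  \<comment> \<open>\<open>f \<le> 1\<close> bounds the set, so that the real \<open>Sup\<close>
    dominates its members.\<close>
  have "bdd_above {min (f b') (g c') | b' c'. mult b c = mult b' c'}"
    using assms unfolding fuzzy_subset_def by (intro bdd_aboveI[of _ 1]) (auto simp: min_le_iff_disj)
  then have "min (f b) (g c) \<le> Sup {min (f b') (g c') | b' c'. mult b c = mult b' c'}"
    by (intro cSup_upper) auto
  moreover have "\<exists>b' c'. mult b c = mult b' c'" by blast
  ultimately show ?thesis
    unfolding fuzzy_prod_def by (simp only: if_True)
qed

lemma fuzzy_prod_one_left_ge:
  assumes "fuzzy_subset f"
  shows "f c \<le> fuzzy_prod mult (\<lambda>_. 1) f (mult b c)"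
proof -
  have "min 1 (f c) = f c" using assms by (simp add: fuzzy_subset_def)
  then show ?thesis
    using fuzzy_prod_ge[of "\<lambda>_. 1" b f c mult] by (simp add: fuzzy_subset_def)
qed

lemma fuzzy_prod_one_right_ge:
  assumes "fuzzy_subset f"
  shows "f b \<le> fuzzy_prod mult f (\<lambda>_. 1) (mult b c)"
proof -
  have "min (f b) 1 = f b" using assms by (simp add: fuzzy_subset_def)
  then show ?thesis
    using fuzzy_prod_ge[OF assms, of b "\<lambda>_. 1" c mult] by simp
qed

text \<open>Where \<open>f a\<close> reaches the threshold, both sides are capped by it. Below the
  threshold, the subgroupoid inequality can only hold through
  \<open>min (f b) (f c) \<le> f a\<close>, for every factorization of \<open>a\<close>.\<close>

lemma prod_k_self_le:
  assumes k: "0 \<le> k" "k < 1" and f: "fuzzy_subgroupoid mult k f"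
  shows "prod_k mult k f f \<le> cut_k k f"
proof (rule le_funI)
  fix a
  have f01: "fuzzy_subset f"
    and sub: "\<And>x y. min (min (f x) (f y)) ((1 - k) / 2) \<le> f (mult x y)"
    using f unfolding fuzzy_subgroupoid_iff[OF k] by simp_all
  show "prod_k mult k f f a \<le> cut_k k f a"
  proof (cases "f a < (1 - k) / 2")
    case small: True
    have "fuzzy_prod mult f f a \<le> f a"
    proof (cases "\<exists>b c. a = mult b c")
      case True
      have "Sup {min (f b) (f c) | b c. a = mult b c} \<le> f a"
      proof (rule cSup_least)
        fix s assume "s \<in> {min (f b) (f c) | b c. a = mult b c}"
        then obtain b c where "s = min (f b) (f c)" "a = mult b c" by blast
        then show "s \<le> f a" using sub[of b c] small by (auto simp: min_le_iff_disj)
      qed (use True in blast)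
      then show ?thesis
        unfolding fuzzy_prod_def if_P[OF True] .
    next
      case False
      \<comment> \<open>Without a factorization the product takes its default value 0.\<close>
      then show ?thesis
        unfolding fuzzy_prod_def if_not_P[OF False] using f01 unfolding fuzzy_subset_def by blast
    qed
    then show ?thesis
      unfolding prod_k_def cut_k_def by linarith
  qed (auto simp only: prod_k_def cut_k_def not_less min.bounded_iff min_le_iff_disj order_refl)
qed

section \<open>Identities from the left invertive law and a left identity\<close>

locale ag_groupoid_left_identity =
  fixes mult :: "'a \<Rightarrow> 'a \<Rightarrow> 'a"  (infixl \<open>\<cdot>\<close> 70) and e :: 'a
  assumes ag: "ag_groupoid mult"
    and left_id: "left_identity mult e"
begin

lemma left_invertive: "(a \<cdot> b) \<cdot> c = (c \<cdot> b) \<cdot> a"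
  using ag unfolding ag_groupoid_def by blast

lemma left_unit [simp]: "e \<cdot> a = a"
  using left_id unfolding left_identity_def by blast

lemma medial: "(a \<cdot> b) \<cdot> (c \<cdot> d) = (a \<cdot> c) \<cdot> (b \<cdot> d)"
proof -
  have "(a \<cdot> b) \<cdot> (c \<cdot> d) = ((c \<cdot> d) \<cdot> b) \<cdot> a" by (rule left_invertive)
  also have "\<dots> = ((b \<cdot> d) \<cdot> c) \<cdot> a" by (simp only: left_invertive[of c d b])
  also have "\<dots> = (a \<cdot> c) \<cdot> (b \<cdot> d)" by (rule left_invertive)
  finally show ?thesis .
qed

lemma left_commute: "a \<cdot> (b \<cdot> c) = b \<cdot> (a \<cdot> c)"
  using medial[of e a b c] by simp

lemma paramedial: "(a \<cdot> b) \<cdot> (c \<cdot> d) = (d \<cdot> c) \<cdot> (b \<cdot> a)"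
proof -
  \<comment> \<open>With \<open>c\<close> pulled out front, the left invertive law can exchange
    \<open>a\<close> and \<open>d\<close>.\<close>
  have "(a \<cdot> b) \<cdot> (c \<cdot> d) = c \<cdot> ((a \<cdot> b) \<cdot> d)" by (rule left_commute)
  also have "\<dots> = c \<cdot> ((d \<cdot> b) \<cdot> a)" by (simp only: left_invertive[of a b d])
  also have "\<dots> = (d \<cdot> b) \<cdot> (c \<cdot> a)" by (rule left_commute)
  also have "\<dots> = (d \<cdot> c) \<cdot> (b \<cdot> a)" by (rule medial)
  finally show ?thesis .
qed

end

section \<open>Consequences of weak regularity\<close>

locale weakly_regular_ag_groupoid = ag_groupoid_left_identity +
  assumes wr: "weakly_regular mult"
begin

lemma square_factors:
  obtains u v where "a = (a \<cdot> a) \<cdot> v" and "a = u \<cdot> (a \<cdot> a)"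
proof -
  obtain x y where xy: "a = (a \<cdot> x) \<cdot> (a \<cdot> y)"
    using wr unfolding weakly_regular_def by blast
  then have "a = (a \<cdot> a) \<cdot> (x \<cdot> y)" by (rule trans) (rule medial)
  moreover from this have "a = (y \<cdot> x) \<cdot> (a \<cdot> a)" by (rule trans) (rule paramedial)
  ultimately show thesis by (rule that)
qed

text \<open>A substitute for commutativity: in \<open>a = a \<cdot> (u \<cdot> a)\<close> the first
  factor can be moved past any \<open>t\<close> by left commutativity.\<close>

lemma mult_in_right_multiples: "\<exists>q. t \<cdot> a = a \<cdot> q"
proof -
  obtain u where "a = u \<cdot> (a \<cdot> a)" by (rule square_factors)
  then have "a = a \<cdot> (u \<cdot> a)" by (rule trans) (rule left_commute)
  then have "t \<cdot> a = t \<cdot> (a \<cdot> (u \<cdot> a))" by (rule arg_cong)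
  also have "\<dots> = a \<cdot> (t \<cdot> (u \<cdot> a))" by (rule left_commute)
  finally show ?thesis ..
qed

lemma intra_regular: "intra_regular mult"
  unfolding intra_regular_def
proof
  fix a
  obtain v where "a = (a \<cdot> a) \<cdot> v" by (rule square_factors)
  then have "a = (e \<cdot> (a \<cdot> a)) \<cdot> v" unfolding left_unit .
  then show "\<exists>x y. a = (x \<cdot> (a \<cdot> a)) \<cdot> y" by blast
qed

lemma regular: "regular mult"
  unfolding regular_def
proof
  fix a
  obtain v where "a = (a \<cdot> a) \<cdot> v" by (rule square_factors)
  then have "a = (v \<cdot> a) \<cdot> a" by (rule trans) (rule left_invertive)
  moreover obtain q where "v \<cdot> a = a \<cdot> q" using mult_in_right_multiples by blast
  ultimately have "a = (a \<cdot> q) \<cdot> a" by metis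
  then show "\<exists>x. a = (a \<cdot> x) \<cdot> a" ..
qed

lemma factorization: "\<exists>q. a = a \<cdot> ((a \<cdot> q) \<cdot> a)"
proof -
  obtain u v where v: "a = (a \<cdot> a) \<cdot> v" and u: "a = u \<cdot> (a \<cdot> a)"
    by (rule square_factors)
  obtain q where q: "(u \<cdot> v) \<cdot> a = a \<cdot> q" using mult_in_right_multiples by blast
  \<comment> \<open>Expanding this \<open>a\<close> by the other square representation brings
    \<open>u \<cdot> a\<close> into the form that the bi-ideal condition controls.\<close>
  have "u \<cdot> a = u \<cdot> ((a \<cdot> a) \<cdot> v)" using v by (rule arg_cong)
  also have "\<dots> = (a \<cdot> a) \<cdot> (u \<cdot> v)" by (rule left_commute)
  also have "\<dots> = (a \<cdot> q) \<cdot> a" by (simp only: left_invertive[of a a] q)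
  finally have ua: "u \<cdot> a = (a \<cdot> q) \<cdot> a" .
  have "a = a \<cdot> (u \<cdot> a)" using u by (rule trans) (rule left_commute)
  then have "a = a \<cdot> ((a \<cdot> q) \<cdot> a)" unfolding ua .
  then show ?thesis ..
qed

lemma quasi_ideal_imp_bi_ideal:
  assumes k: "0 \<le> k" "k < 1" and f: "fuzzy_quasi_ideal mult k f"
  shows "fuzzy_bi_ideal mult k f"
proof -
  have f01: "fuzzy_subset f"
    and quasi: "min (min (fuzzy_prod mult f (\<lambda>_. 1) x) (fuzzy_prod mult (\<lambda>_. 1) f x)) ((1 - k) / 2)
      \<le> f x" for x
    using f unfolding fuzzy_quasi_ideal_def by blast+
  \<comment> \<open>An element of both \<open>bS\<close> and \<open>Sc\<close> bounds the two
    products in the quasi-ideal condition from below by \<open>f b\<close> and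
    \<open>f c\<close>.\<close>
  have ge: "min (min (f b) (f c)) ((1 - k) / 2) \<le> f w" if "w = b \<cdot> p" "w = q \<cdot> c" for b c p q w
  proof -
    have "f b \<le> fuzzy_prod mult f (\<lambda>_. 1) w" "f c \<le> fuzzy_prod mult (\<lambda>_. 1) f w"
      using fuzzy_prod_one_right_ge[OF f01] fuzzy_prod_one_left_ge[OF f01] that by metis+
    then show ?thesis using quasi[of w] by (auto simp: min_le_iff_disj)
  qed
  have "min (min (f x) (f z)) ((1 - k) / 2) \<le> f ((x \<cdot> y) \<cdot> z)" for x y z
  proof -
    \<comment> \<open>\<open>(x \<cdot> y) \<cdot> z = (z \<cdot> y) \<cdot> x\<close> is a left
      multiple of \<open>x\<close>, hence also a right one.\<close>
    obtain p where "(x \<cdot> y) \<cdot> z = x \<cdot> p"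
      using left_invertive[of x y z] mult_in_right_multiples by metis
    then show ?thesis using ge by blast
  qed
  then show ?thesis
    using ge f01 by (auto simp: fuzzy_bi_ideal_iff[OF k] fuzzy_subgroupoid_iff[OF k])
qed

text \<open>The factorization of \<open>a\<close> is one candidate in the supremum; its second
  factor costs \<open>g\<close> at most the cut at \<open>(1 - k) / 2\<close>, which
  \<open>meet_k\<close> already contains.\<close>

lemma prod_k_ge_meet_k:
  assumes k: "0 \<le> k" "k < 1" and f: "fuzzy_subset f" and g: "fuzzy_bi_ideal mult k g"
  shows "meet_k k f g \<le> prod_k mult k f g"
proof (rule le_funI)
  fix a
  obtain q where q: "a = a \<cdot> ((a \<cdot> q) \<cdot> a)" using factorization by blast
  have "min (g a) ((1 - k) / 2) \<le> g ((a \<cdot> q) \<cdot> a)"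
    using g unfolding fuzzy_bi_ideal_iff[OF k] by (metis min.idem)
  moreover have "min (f a) (g ((a \<cdot> q) \<cdot> a)) \<le> fuzzy_prod mult f g a"
    using fuzzy_prod_ge[OF f, of a g "(a \<cdot> q) \<cdot> a" mult] unfolding q[symmetric] .
  ultimately show "meet_k k f g a \<le> prod_k mult k f g a"
    unfolding meet_k_def prod_k_def
    by (auto simp only: min.bounded_iff min_le_iff_disj order_refl)
qed

lemma prod_k_self:
  assumes k: "0 \<le> k" "k < 1" and f: "fuzzy_bi_ideal mult k f"
  shows "prod_k mult k f f = cut_k k f"
proof (rule antisym)
  have sub: "fuzzy_subgroupoid mult k f" and f01: "fuzzy_subset f"
    using f unfolding fuzzy_bi_ideal_def fuzzy_subgroupoid_def by blast+
  show "prod_k mult k f f \<le> cut_k k f"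
    by (rule prod_k_self_le[OF k sub])
  have "cut_k k f = meet_k k f f"
    by (simp add: fun_eq_iff cut_k_def meet_k_def)
  then show "cut_k k f \<le> prod_k mult k f f"
    using prod_k_ge_meet_k[OF k f01 f] by simp
qed

end

theorem theorem21:
  fixes mult :: "'a \<Rightarrow> 'a \<Rightarrow> 'a" and e :: 'a and k :: real
  assumes "0 \<le> k" and "k < 1"
    and "ag_groupoid mult"
    and "left_identity mult e"
    and "weakly_regular mult"
  shows
    "((regular mult \<and> intra_regular mult) \<longleftrightarrow>
       (\<forall>f. fuzzy_quasi_ideal mult k f \<longrightarrow> prod_k mult k f f = cut_k k f)) \<and>
     ((regular mult \<and> intra_regular mult) \<longleftrightarrow>
       (\<forall>f. fuzzy_bi_ideal mult k f \<longrightarrow> prod_k mult k f f = cut_k k f)) \<and>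
     ((regular mult \<and> intra_regular mult) \<longleftrightarrow>
       (\<forall>f g. fuzzy_quasi_ideal mult k f \<longrightarrow> fuzzy_quasi_ideal mult k g \<longrightarrow>
          prod_k mult k f g \<ge> meet_k k f g)) \<and>
     ((regular mult \<and> intra_regular mult) \<longleftrightarrow>
       (\<forall>f g. fuzzy_quasi_ideal mult k f \<longrightarrow> fuzzy_bi_ideal mult k g \<longrightarrow>
          prod_k mult k f g \<ge> meet_k k f g)) \<and>
     ((regular mult \<and> intra_regular mult) \<longleftrightarrow>
       (\<forall>f g. fuzzy_bi_ideal mult k f \<longrightarrow> fuzzy_bi_ideal mult k g \<longrightarrow>
          prod_k mult k f g \<ge> meet_k k f g))"
proof -
  interpret weakly_regular_ag_groupoid mult e
    using assms by unfold_locales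
  note k = assms(1,2)
  have q: "fuzzy_bi_ideal mult k f" if "fuzzy_quasi_ideal mult k f" for f
    using quasi_ideal_imp_bi_ideal[OF k that] .
  have s: "fuzzy_subset f" if "fuzzy_bi_ideal mult k f" for f
    using that unfolding fuzzy_bi_ideal_def fuzzy_subgroupoid_def by blast
  show ?thesis
    \<comment> \<open>Both sides of each equivalence hold outright; \<open>q\<close> reduces
      quasi-ideals to bi-ideals.\<close>
    using regular intra_regular q s prod_k_self[OF k] prod_k_ge_meet_k[OF k] by blast
qed

end
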